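(* Let $(u_i)_{i\in\mathbb N}$ be a random family of non-negative numbers with $\mathbb E\left(\sum_{i\in\mathbb N}u_i\right)=1$, and let $(G_n(1))_{n\in\mathbb N}$ be the associated Mandelbrot cascade total mass process (see context). If there exists $p\in(1,2]$ such that $$\mathbb E\left[\left(\sum_{i\in\mathbb N}u_i\right)\log_+\left(\sum_{i\in\mathbb N}u_i\right)\right]<+\infty\quad\text{and}\quad\mathbb E\left[\sum_{i\in\mathbb N}u_i^p\right]<1,$$ then the martingale $(G_n(1))_{n\in\mathbb N}$ is uniformly integrable.
   Context: $\mathbb N=\{0,1,2,\dots\}$ and $\log_+ x=\max(\log x,0)$ (with $0\log_+0=0$). For $n\ge0$ and $e\in\mathbb N^n$ (with $\mathbb N^0=\{\emptyset\}$), let $(u_{ei})_{i\in\mathbb N}$ be independent (over all finite words $e$) copies of the random family $(u_i)_{i\in\mathbb N}$, where $ei$ denotes concatenation. Set $w_\emptyset=1$, $w_{ei}=w_eu_{ei}$ and $G_n(1)=\sum_{e\in\mathbb N^n}w_e$ (so $G_0(1)=1$). This is the weighted branching process with a single type and initial configuration a single particle of weight 1; since $\mathbb E(\sum_iu_i)=1$, $(G_n(1))_n$ is a non-negative martingale. *)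

theory Defs
  imports "HOL-Probability.Probability"
begin

definition log_plus :: "ennreal \<Rightarrow> ennreal" where
  "log_plus x = (if x = \<infinity> then \<infinity> else ennreal (max (ln (enn2real x)) 0))"

text \<open>
  A word over the natural numbers is a list, and \<open>e i\<close> is \<open>e @ [i]\<close>. The variable attached
  to the nonempty word \<open>v\<close> is \<open>U v\<close>; the value \<open>U []\<close> is never used.
\<close>

fun weight :: "(nat list \<Rightarrow> 'a \<Rightarrow> real) \<Rightarrow> nat list \<Rightarrow> 'a \<Rightarrow> real" where
  "weight U e x = (if e = [] then 1 else weight U (butlast e) x * U e x)"

declare weight.simps [simp del]

lemma weight_Nil [simp]: "weight U [] x = 1"
  by (simp add: weight.simps)

lemma weight_snoc [simp]: "weight U (e @ [i]) x = weight U e x * U (e @ [i]) x"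
  by (subst weight.simps) simp

text \<open>
  The sum is taken in the extended non-negative reals, so that no convergence convention
  intervenes.
\<close>

definition total_mass :: "(nat list \<Rightarrow> 'a \<Rightarrow> real) \<Rightarrow> nat \<Rightarrow> 'a \<Rightarrow> ennreal" where
  "total_mass U n x = (\<Sum>\<^sub>\<infinity>e\<in>{e. length e = n}. ennreal (weight U e x))"

lemma total_mass_0: "total_mass U 0 x = 1"
  by (simp add: total_mass_def)

definition independent_copies ::
  "'a measure \<Rightarrow> (nat list \<Rightarrow> 'a \<Rightarrow> real) \<Rightarrow> 'b measure \<Rightarrow> (nat \<Rightarrow> 'b \<Rightarrow> real) \<Rightarrow> bool" where
  "independent_copies M U N u \<longleftrightarrow>
     prob_space.indep_vars M (\<lambda>_. \<Pi>\<^sub>M i\<in>UNIV. (borel :: real measure))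
       (\<lambda>e x i. U (e @ [i]) x) (UNIV :: nat list set) \<and>
     (\<forall>e. distr M (\<Pi>\<^sub>M i\<in>UNIV. borel) (\<lambda>x i. U (e @ [i]) x) =
          distr N (\<Pi>\<^sub>M i\<in>UNIV. borel) (\<lambda>y i. u i y))"

text \<open>
  Uniform integrability of a family of non-negative random variables. Values in the extended
  reals are allowed; the tail condition forces each variable to be integrable, hence almost
  everywhere finite.
\<close>

definition uniformly_integrable :: "'a measure \<Rightarrow> 'i set \<Rightarrow> ('i \<Rightarrow> 'a \<Rightarrow> ennreal) \<Rightarrow> bool" where
  "uniformly_integrable M I X \<longleftrightarrow>
     (\<forall>n\<in>I. X n \<in> borel_measurable M) \<and>
     ((\<lambda>K::real. SUP n\<in>I. \<integral>\<^sup>+x\<in>{x \<in> space M. X n x > ennreal K}. X n x \<partial>M)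
        \<longlongrightarrow> 0) at_top"

end

theory Submission
  imports Defs
begin

text \<open>
  The increments \<open>G\<^sub>n\<^sub>+\<^sub>1 - G\<^sub>n\<close> are summable in \<open>L\<^sup>1\<close>; so the sequence is Cauchy in \<open>L\<^sup>1\<close>, hence uniformly
  integrable (\<open>uniformly_integrable_if_summable_increments\<close>).

  Write \<open>S\<^sub>e = \<Sum>\<^sub>i u\<^sub>e\<^sub>i\<close>, so that \<open>G\<^sub>n\<^sub>+\<^sub>1 - G\<^sub>n\<close> is the sum of \<open>w\<^sub>e (S\<^sub>e - 1)\<close> over the words \<open>e\<close> of length
  \<open>n\<close>. For each of these words \<open>w\<^sub>e\<close> is independent of \<open>S\<^sub>e\<close>. Put \<open>\<mu> = E \<Sum>\<^sub>i u\<^sub>i\<^sup>p < 1\<close>; then the sum of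
  \<open>E w\<^sub>e\<^sup>p\<close> over words of length \<open>n\<close> is \<open>\<mu>\<^sup>n\<close>. Choose \<open>r > 1\<close> with \<open>\<mu> r < 1\<close> and discard from
  the sum the terms with \<open>w\<^sub>e > 1\<close> or \<open>S\<^sub>e > r\<^sup>n\<close>.

    \<^item> The terms with \<open>w\<^sub>e > 1\<close> cost at most a multiple of \<open>\<Sum>\<^sub>e E w\<^sub>e\<^sup>p = \<mu>\<^sup>n\<close> in mean, as \<open>w \<le> w\<^sup>p\<close> for \<open>w \<ge> 1\<close>.

    \<^item> The terms with \<open>S\<^sub>e > r\<^sup>n\<close> cost at most a multiple of \<open>E (S; S > r\<^sup>n)\<close>, and summing this over \<open>n\<close> gives a
      quantity of order \<open>E S (1 + log\<^sub>+ S)\<close> (\<open>summable_offspring_tail\<close>).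

    \<^item> The remaining terms, once centred, are orthogonal in \<open>L\<^sup>2\<close> (\<open>expectation_square_sum\<close>). As
      \<open>w\<^sup>2 \<le> w\<^sup>p\<close> for \<open>w \<le> 1\<close>, the square of their sum has mean at most
      \<open>\<Sum>\<^sub>e E w\<^sub>e\<^sup>p \<cdot> E (S\<^sup>2; S \<le> r\<^sup>n) \<le> \<mu>\<^sup>n r\<^sup>n\<close>, so their sum has \<open>L\<^sup>1\<close> norm at most \<open>(\<mu> r)\<^sup>n\<^sup>/\<^sup>2\<close>.

  Cutting both \<open>w\<close> and \<open>S\<close> thus reduces every \<open>p\<close> in \<open>(1, 2]\<close> to an \<open>L\<^sup>2\<close> computation with bounded
  variables. To work with finite sums of reals, the bound is first proved for the cascade restricted
  to letters below \<open>k\<close> (\<open>truncated_increment\<close>). This restricted cascade has offspring mean at most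
  \<open>1\<close>, converging to \<open>1\<close> as \<open>k\<close> grows, and Fatou's lemma carries the bound to the full cascade
  (\<open>total_mass_increment\<close>).
\<close>

section \<open>A criterion for uniform integrability\<close>

definition tail_mass :: "'a measure \<Rightarrow> ('a \<Rightarrow> ennreal) \<Rightarrow> real \<Rightarrow> ennreal" where
  "tail_mass M X K = (\<integral>\<^sup>+x\<in>{x \<in> space M. X x > ennreal K}. X x \<partial>M)"

lemma tail_mass_antimono: "K \<le> L \<Longrightarrow> tail_mass M X L \<le> tail_mass M X K"
  unfolding tail_mass_def
  by (intro nn_integral_mono mult_left_mono)
     (auto split: split_indicator dest: ennreal_leI order.strict_trans1)

lemma tail_mass_tendsto_0:
  assumes [measurable]: "X \<in> borel_measurable M" and fin: "(\<integral>\<^sup>+x. X x \<partial>M) < \<infinity>"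
  shows "(tail_mass M X \<longlongrightarrow> 0) at_top"
proof (rule order_tendstoI)
  fix a :: ennreal assume a: "0 < a"
  have AEfin: "AE x in M. X x \<noteq> \<infinity>"
    by (rule nn_integral_PInf_AE) (use fin in auto)
  have "(\<lambda>n. \<integral>\<^sup>+x. X x * indicator {x \<in> space M. X x > ennreal (real n)} x \<partial>M)
          \<longlonglongrightarrow> (\<integral>\<^sup>+x. 0 \<partial>M)"
  proof (rule nn_integral_dominated_convergence[where w = X])
    show "AE x in M. (\<lambda>n. X x * indicator {x \<in> space M. X x > ennreal (real n)} x) \<longlonglongrightarrow> 0"
      using AEfin
    proof eventually_elim
      case (elim x)
      obtain k :: nat where "enn2real (X x) \<le> real k" using real_arch_simple by blast
      hence k: "X x \<le> ennreal (real n)" if "n \<ge> k" for n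
        using elim that by (cases "X x") (auto intro!: ennreal_leI)
      have "\<forall>\<^sub>F n in sequentially. X x * indicator {x \<in> space M. X x > ennreal (real n)} x = 0"
        using eventually_ge_at_top[of k]
        by eventually_elim (use k in \<open>auto simp: not_less split: split_indicator\<close>)
      thus ?case by (rule tendsto_eventually)
    qed
  qed (use fin in \<open>auto split: split_indicator\<close>)
  hence "(\<lambda>n. tail_mass M X (real n)) \<longlonglongrightarrow> 0"
    by (simp add: tail_mass_def)
  from order_tendstoD(2)[OF this a] obtain n where n: "tail_mass M X (real n) < a"
    by (auto simp: eventually_sequentially)
  show "\<forall>\<^sub>F K in at_top. tail_mass M X K < a"
    using eventually_ge_at_top[of "real n"]
    by eventually_elim (use n tail_mass_antimono in \<open>blast intro: order.strict_trans1\<close>)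
qed simp

text \<open>
  If \<open>f x > K\<close> and \<open>g x \<le> K / 2\<close>, then more than half of \<open>f x\<close> comes from \<open>f x - g x\<close>; otherwise
  \<open>f x \<le> \<bar>f x - g x\<bar> + g x\<close> with \<open>g x\<close> above the level \<open>K / 2\<close>.
\<close>

lemma tail_mass_compare:
  assumes [measurable]: "f \<in> borel_measurable M" "g \<in> borel_measurable M"
    and K: "0 \<le> K"
    and nonneg: "\<And>x. 0 \<le> f x" "\<And>x. 0 \<le> g x"
  shows "tail_mass M (\<lambda>x. ennreal (f x)) K
     \<le> 2 * (\<integral>\<^sup>+x. ennreal \<bar>f x - g x\<bar> \<partial>M) + tail_mass M (\<lambda>x. ennreal (g x)) (K / 2)"
proof -
  have "tail_mass M (\<lambda>x. ennreal (f x)) K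
      \<le> (\<integral>\<^sup>+x. 2 * ennreal \<bar>f x - g x\<bar>
           + ennreal (g x) * indicator {x \<in> space M. ennreal (g x) > ennreal (K / 2)} x \<partial>M)"
    unfolding tail_mass_def
  proof (rule nn_integral_mono)
    fix x assume "x \<in> space M"
    have "ennreal (f x) \<le> 2 * ennreal \<bar>f x - g x\<bar>" if "K < f x" "g x \<le> K / 2"
    proof -
      have "f x \<le> 2 * (f x - g x)" using that by simp
      also have "\<dots> \<le> 2 * \<bar>f x - g x\<bar>" by (intro mult_left_mono abs_ge_self) simp
      finally have "ennreal (f x) \<le> ennreal (2 * \<bar>f x - g x\<bar>)" by (rule ennreal_leI)
      thus ?thesis by (simp add: ennreal_mult)
    qed
    moreover have "ennreal (f x) \<le> 2 * ennreal \<bar>f x - g x\<bar> + ennreal (g x)"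
    proof -
      define d where "d = \<bar>f x - g x\<bar>"
      have "f x - g x \<le> d" "0 \<le> d" by (simp_all add: d_def)
      hence "ennreal (f x) \<le> ennreal (2 * d + g x)" by (intro ennreal_leI) linarith
      thus ?thesis using nonneg[of x] by (simp add: d_def ennreal_mult ennreal_plus)
    qed
    ultimately show "ennreal (f x) * indicator {x \<in> space M. ennreal K < ennreal (f x)} x
        \<le> 2 * ennreal \<bar>f x - g x\<bar>
          + ennreal (g x) * indicator {x \<in> space M. ennreal (g x) > ennreal (K / 2)} x"
      using K nonneg[of x] by (auto split: split_indicator simp: ennreal_less_iff not_less)
  qed
  also have "\<dots> = 2 * (\<integral>\<^sup>+x. ennreal \<bar>f x - g x\<bar> \<partial>M) + tail_mass M (\<lambda>x. ennreal (g x)) (K / 2)"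
    unfolding tail_mass_def by (subst nn_integral_add) (auto simp: nn_integral_cmult)
  finally show ?thesis .
qed

text \<open>
  Beyond some index \<open>m\<close> all \<open>X n\<close> are \<open>L\<^sup>1\<close>-close to \<open>X m\<close>, and \<open>tail_mass_compare\<close> bounds their tails
  by that of \<open>X m\<close>; the finitely many variables up to \<open>m\<close> have small tails by dominated convergence.
\<close>

lemma uniformly_integrable_if_summable_increments:
  fixes X :: "nat \<Rightarrow> 'a \<Rightarrow> ennreal" and b :: "nat \<Rightarrow> real"
  assumes meas [measurable]: "\<And>n. X n \<in> borel_measurable M"
    and fin: "\<And>n. (\<integral>\<^sup>+x. X n x \<partial>M) < \<infinity>"
    and inc: "\<And>n. (\<integral>\<^sup>+x. ennreal \<bar>enn2real (X (Suc n) x) - enn2real (X n x)\<bar> \<partial>M) \<le> ennreal (b n)"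
    and b_nonneg: "\<And>n. 0 \<le> b n" and b: "summable b"
  shows "uniformly_integrable M UNIV X"
proof -
  define g where "g n x = enn2real (X n x)" for n x
  have [measurable]: "g n \<in> borel_measurable M" for n unfolding g_def by measurable
  have g0: "0 \<le> g n x" for n x by (simp add: g_def)
  have tail_g: "tail_mass M (X n) K = tail_mass M (\<lambda>x. ennreal (g n x)) K" for n K
  proof -
    have "AE x in M. X n x \<noteq> \<infinity>"
      by (rule nn_integral_PInf_AE) (use fin[of n] in auto)
    hence "AE x in M. X n x = ennreal (g n x)"
      by eventually_elim (auto simp: g_def less_top)
    thus ?thesis unfolding tail_mass_def
      by (intro nn_integral_cong_AE) (auto split: split_indicator)
  qed
  have dist: "(\<integral>\<^sup>+x. ennreal \<bar>g n x - g m x\<bar> \<partial>M) \<le> ennreal (sum b {m..<n})" if "m \<le> n" for m n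
    using that
  proof (induction n rule: dec_induct)
    case (step n)
    have "(\<integral>\<^sup>+x. ennreal \<bar>g (Suc n) x - g m x\<bar> \<partial>M)
        \<le> (\<integral>\<^sup>+x. ennreal \<bar>g n x - g m x\<bar> + ennreal \<bar>g (Suc n) x - g n x\<bar> \<partial>M)"
      by (intro nn_integral_mono) (auto simp flip: ennreal_plus intro!: ennreal_leI)
    also have "\<dots> = (\<integral>\<^sup>+x. ennreal \<bar>g n x - g m x\<bar> \<partial>M) + (\<integral>\<^sup>+x. ennreal \<bar>g (Suc n) x - g n x\<bar> \<partial>M)"
      by (rule nn_integral_add) auto
    also have "\<dots> \<le> ennreal (sum b {m..<n}) + ennreal (b n)"
      by (intro add_mono step.IH) (use inc[of n] in \<open>simp add: g_def\<close>)
    also have "\<dots> = ennreal (sum b {m..<Suc n})"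
      using step.hyps b_nonneg by (subst ennreal_plus[symmetric]) (auto intro: sum_nonneg)
    finally show ?case .
  qed simp
  have "((\<lambda>K. SUP n. tail_mass M (X n) K) \<longlongrightarrow> 0) at_top"
  proof (rule order_tendstoI)
    fix a :: ennreal assume "0 < a"
    then obtain c where c: "0 < c" "c < a" using dense by blast
    then obtain \<epsilon> where \<epsilon>: "c = ennreal \<epsilon>" "0 < \<epsilon>" by (cases c) (auto simp: ennreal_less_zero_iff)
    from b obtain m where m: "\<And>n. n \<ge> m \<Longrightarrow> norm (sum b {m..<n}) < \<epsilon> / 4"
      unfolding summable_Cauchy using \<epsilon>(2)
      by (meson divide_pos_pos zero_less_numeral order_refl)
    have "\<forall>\<^sub>F K in at_top. \<forall>j\<in>{..m}. tail_mass M (X j) K < ennreal (\<epsilon> / 2)"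
      by (intro eventually_ball_finite ballI order_tendstoD(2)[OF tail_mass_tendsto_0] fin)
         (use \<epsilon> in auto)
    moreover have "filterlim (\<lambda>K::real. K / 2) at_top at_top"
      unfolding filterlim_at_top
    proof
      fix Z :: real
      show "\<forall>\<^sub>F K in at_top. Z \<le> K / 2"
        using eventually_ge_at_top[of "2 * Z"] by eventually_elim simp
    qed
    ultimately have "\<forall>\<^sub>F K in at_top. \<forall>j\<in>{..m}. tail_mass M (X j) (K / 2) < ennreal (\<epsilon> / 2)"
      by (rule eventually_compose_filterlim)
    thus "\<forall>\<^sub>F K in at_top. (SUP n. tail_mass M (X n) K) < a"
      using eventually_ge_at_top[of 0]
    proof eventually_elim
      case (elim K)
      have "tail_mass M (X n) K \<le> c" for n
      proof (cases "n \<le> m")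
        case True
        have "tail_mass M (X n) K \<le> tail_mass M (X n) (K / 2)"
          using elim by (intro tail_mass_antimono) auto
        also have "\<dots> \<le> ennreal (\<epsilon> / 2)" using elim(1) True by (auto intro: less_imp_le)
        also have "\<dots> \<le> c" using \<epsilon> by (auto intro!: ennreal_leI)
        finally show ?thesis .
      next
        case False
        have "tail_mass M (X n) K
            \<le> 2 * (\<integral>\<^sup>+x. ennreal \<bar>g n x - g m x\<bar> \<partial>M) + tail_mass M (\<lambda>x. ennreal (g m x)) (K / 2)"
          unfolding tail_g[of n] using elim g0 by (intro tail_mass_compare) auto
        also have "\<dots> \<le> 2 * ennreal (\<epsilon> / 4) + ennreal (\<epsilon> / 2)"
        proof (intro add_mono mult_left_mono)
          have "sum b {m..<n} \<le> \<epsilon> / 4" using m[of n] False by auto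
          thus "(\<integral>\<^sup>+x. ennreal \<bar>g n x - g m x\<bar> \<partial>M) \<le> ennreal (\<epsilon> / 4)"
            using order.trans[OF dist[of m n] ennreal_leI] False by simp
          show "tail_mass M (\<lambda>x. ennreal (g m x)) (K / 2) \<le> ennreal (\<epsilon> / 2)"
            using elim(1) by (auto simp: tail_g intro: less_imp_le)
        qed auto
        also have "\<dots> = ennreal (2 * (\<epsilon> / 4) + \<epsilon> / 2)"
          using \<epsilon>(2) by (subst ennreal_plus, simp, simp, subst ennreal_mult) auto
        also have "\<dots> = c" using \<epsilon> by simp
        finally show ?thesis .
      qed
      hence "(SUP n. tail_mass M (X n) K) \<le> c" by (rule SUP_least)
      with c show ?case by simp
    qed
  qed simp
  thus ?thesis unfolding uniformly_integrable_def tail_mass_def using meas by simp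
qed

section \<open>Words over finitely many letters\<close>

definition words :: "nat \<Rightarrow> nat \<Rightarrow> nat list set" where
  "words k n = {e. set e \<subseteq> {..<k} \<and> length e = n}"

lemma finite_words [simp]: "finite (words k n)"
  unfolding words_def by (rule finite_lists_length_eq) simp

lemma words_0 [simp]: "words k 0 = {[]}"
  by (auto simp: words_def)

lemma length_words: "e \<in> words k n \<Longrightarrow> length e = n"
  by (simp add: words_def)

lemma words_mono: "k \<le> l \<Longrightarrow> words k n \<subseteq> words l n"
  by (auto simp: words_def)

lemma sum_words_Suc: "sum f (words k (Suc n)) = (\<Sum>e\<in>words k n. \<Sum>i<k. f (e @ [i]))"
proof -
  have "words k (Suc n) = (\<lambda>(e, i). e @ [i]) ` (words k n \<times> {..<k})"
  proof (intro equalityI subsetI)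
    fix e assume "e \<in> words k (Suc n)"
    thus "e \<in> (\<lambda>(e, i). e @ [i]) ` (words k n \<times> {..<k})"
      by (cases e rule: rev_cases) (auto simp: words_def)
  qed (auto simp: words_def)
  moreover have "inj_on (\<lambda>(e, i). e @ [i]) (words k n \<times> {..<k})"
    by (auto simp: inj_on_def)
  ultimately show ?thesis
    by (simp add: sum.reindex sum.cartesian_product case_prod_unfold)
qed

text \<open>
  The sets \<open>words k n\<close> are cofinal among the finite sets of words of length \<open>n\<close>.
\<close>

lemma total_mass_eq_SUP:
  "total_mass U n x = (SUP k. \<Sum>e\<in>words k n. ennreal (weight U e x))"
  unfolding total_mass_def
proof (subst nonneg_infsum_complete, simp, intro antisym SUP_least)
  fix F assume F: "F \<in> {F. finite F \<and> F \<subseteq> {e::nat list. length e = n}}"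
  hence "finite (\<Union>(set ` F))" by auto
  then obtain k where "\<forall>i\<in>\<Union>(set ` F). i < k"
    using finite_nat_set_iff_bounded by blast
  hence "F \<subseteq> words k n" using F by (auto simp: words_def)
  hence "(\<Sum>e\<in>F. ennreal (weight U e x)) \<le> (\<Sum>e\<in>words k n. ennreal (weight U e x))"
    by (intro sum_mono2) auto
  thus "(\<Sum>e\<in>F. ennreal (weight U e x)) \<le> (SUP k. \<Sum>e\<in>words k n. ennreal (weight U e x))"
    by (rule SUP_upper2[OF UNIV_I])
next
  fix k
  show "(\<Sum>e\<in>words k n. ennreal (weight U e x))
      \<le> (SUP F\<in>{F. finite F \<and> F \<subseteq> {e. length e = n}}. \<Sum>e\<in>F. ennreal (weight U e x))"
    by (intro SUP_upper) (auto dest: length_words)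
qed

section \<open>Independence in the cascade\<close>

lemma weight_Nil_fun: "weight U [] = (\<lambda>_. 1)"
  by (simp add: fun_eq_iff)

abbreviation families :: "(nat \<Rightarrow> real) measure" where
  "families \<equiv> \<Pi>\<^sub>M i\<in>UNIV. borel"

text \<open>
  The weight of a word as a function of a labelling \<open>z\<close>, where \<open>z e i\<close> stands for the variable
  attached to \<open>e @ [i]\<close>. In this form it depends only on the coordinates of \<open>z\<close> at proper prefixes of the
  word, which is what the independence arguments use.
\<close>

abbreviation family_weight :: "nat list \<Rightarrow> (nat list \<Rightarrow> nat \<Rightarrow> real) \<Rightarrow> real" where
  "family_weight \<equiv> weight (\<lambda>d z. z (butlast d) (last d))"

lemma weight_measurable_families [measurable]:
  assumes "\<And>c. length c < length d \<Longrightarrow> c \<in> K"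
  shows "(\<lambda>z. family_weight d z) \<in> borel_measurable (\<Pi>\<^sub>M e\<in>K. families)"
  using assms
proof (induction d rule: rev_induct)
  case (snoc i d)
  have [measurable]: "(\<lambda>z. z d) \<in> (\<Pi>\<^sub>M e\<in>K. families) \<rightarrow>\<^sub>M families"
    using snoc.prems[of d] by (intro measurable_component_singleton) auto
  have [measurable]: "(\<lambda>z. z d i) \<in> borel_measurable (\<Pi>\<^sub>M e\<in>K. families)"
    by (rule measurable_compose[OF _ measurable_component_singleton[of i UNIV "\<lambda>_. borel"]]) auto
  show ?case using snoc by simp
qed (simp add: weight_Nil_fun)

locale cascade = prob_space M for M :: "'a measure" +
  fixes U :: "nat list \<Rightarrow> 'a \<Rightarrow> real" and N :: "'b measure" and u :: "nat \<Rightarrow> 'b \<Rightarrow> real"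
  assumes N: "prob_space N"
    and u_meas [measurable]: "\<And>i. u i \<in> borel_measurable N"
    and u_nonneg: "\<And>i y. y \<in> space N \<Longrightarrow> 0 \<le> u i y"
    and mean_one: "(\<integral>\<^sup>+y. (\<Sum>i. ennreal (u i y)) \<partial>N) = 1"
    and copies: "independent_copies M U N u"
begin

definition children :: "nat list \<Rightarrow> 'a \<Rightarrow> nat \<Rightarrow> real" where
  "children e x = (\<lambda>i. U (e @ [i]) x)"

lemma indep_children: "indep_vars (\<lambda>_. families) children UNIV"
  using copies unfolding independent_copies_def children_def by simp

lemma children_meas [measurable]: "children e \<in> M \<rightarrow>\<^sub>M families"
  using indep_children by (simp add: indep_vars_def)

lemma u_family_meas [measurable]: "(\<lambda>y i. u i y) \<in> N \<rightarrow>\<^sub>M families"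
  by (rule measurable_PiM_single') auto

lemma distr_children: "distr M families (children e) = distr N families (\<lambda>y i. u i y)"
  using copies unfolding independent_copies_def children_def by simp

lemma U_meas [measurable]: "U (e @ [i]) \<in> borel_measurable M"
  using measurable_compose[OF children_meas[of e] measurable_component_singleton[of i UNIV]]
  by (simp add: children_def)

text \<open>
  Every \<open>children e\<close> has the law of the family \<open>u\<close>, so expectations of its functions are computed
  on \<open>N\<close>.
\<close>

lemma integrable_children:
  fixes f :: "(nat \<Rightarrow> real) \<Rightarrow> real"
  assumes [measurable]: "f \<in> borel_measurable families"
  shows "integrable M (\<lambda>x. f (children e x)) \<longleftrightarrow> integrable N (\<lambda>y. f (\<lambda>i. u i y))"
proof -
  have "integrable M (\<lambda>x. f (children e x)) \<longleftrightarrow> integrable (distr M families (children e)) f"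
    by (subst integrable_distr_eq) auto
  also have "\<dots> \<longleftrightarrow> integrable N (\<lambda>y. f (\<lambda>i. u i y))"
    unfolding distr_children by (subst integrable_distr_eq) auto
  finally show ?thesis .
qed

lemma integral_children:
  fixes f :: "(nat \<Rightarrow> real) \<Rightarrow> real"
  assumes [measurable]: "f \<in> borel_measurable families"
  shows "(\<integral>x. f (children e x) \<partial>M) = (\<integral>y. f (\<lambda>i. u i y) \<partial>N)"
proof -
  have "(\<integral>x. f (children e x) \<partial>M) = integral\<^sup>L (distr M families (children e)) f"
    by (subst integral_distr) auto
  also have "\<dots> = (\<integral>y. f (\<lambda>i. u i y) \<partial>N)"
    unfolding distr_children by (subst integral_distr) auto
  finally show ?thesis .
qed

lemma AE_U_nonneg: "AE x in M. \<forall>e i. 0 \<le> U (e @ [i]) x"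
proof -
  have "AE x in M. 0 \<le> U (e @ [i]) x" for e i
  proof -
    have "AE z in distr N families (\<lambda>y i. u i y). 0 \<le> z i"
      by (subst AE_distr_iff) (auto intro: u_nonneg)
    hence "AE x in M. 0 \<le> children e x i"
      unfolding distr_children[of e, symmetric] by (subst (asm) AE_distr_iff) auto
    thus ?thesis by (simp add: children_def)
  qed
  thus ?thesis by (simp add: AE_all_countable)
qed

lemma AE_weight_nonneg: "AE x in M. \<forall>e. 0 \<le> weight U e x"
  using AE_U_nonneg
proof eventually_elim
  case (elim x)
  have "0 \<le> weight U e x" for e
    using elim by (induction e rule: rev_induct) auto
  thus ?case by simp
qed

lemma weight_meas [measurable]: "weight U e \<in> borel_measurable M"
proof (induction e rule: rev_induct)
  case (snoc i e)
  thus ?case by (simp add: weight_snoc cong: measurable_cong)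
qed (simp add: weight_Nil_fun)

text \<open>
  A word no longer than \<open>e\<close> never has \<open>e\<close> as a proper prefix, so its weight is not affected by the
  offspring of \<open>e\<close>.
\<close>

lemma weight_other_children:
  assumes "length d \<le> length e"
  shows "weight U d x = family_weight d (restrict (\<lambda>c. children c x) (- {e}))"
  using assms by (induction d rule: rev_induct) (auto simp: children_def)

lemma indep_var_children:
  assumes "f \<in> borel_measurable (\<Pi>\<^sub>M c\<in>- {e}. families)" "g \<in> borel_measurable families"
  shows "indep_var borel (\<lambda>x. f (restrict (\<lambda>c. children c x) (- {e})) :: real)
                   borel (\<lambda>x. g (children e x) :: real)"
proof -
  have indep: "indep_var (\<Pi>\<^sub>M c\<in>- {e}. families) (\<lambda>x. restrict (\<lambda>c. children c x) (- {e}))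
                  (\<Pi>\<^sub>M c\<in>{e}. families) (\<lambda>x. restrict (\<lambda>c. children c x) {e})"
    by (rule indep_var_restrict[OF indep_children]) auto
  have "(\<lambda>z. g (z e)) \<in> borel_measurable (\<Pi>\<^sub>M c\<in>{e}. families)"
    by (rule measurable_compose[OF measurable_component_singleton[of e "{e}" "\<lambda>_. families"] assms(2)]) auto
  from indep_var_compose[OF indep assms(1) this] have "indep_var borel (f \<circ> (\<lambda>x. restrict (\<lambda>c. children c x) (- {e})))
      borel ((\<lambda>z. g (z e)) \<circ> (\<lambda>x. restrict (\<lambda>c. children c x) {e}))"
    .
  thus ?thesis by (simp add: o_def)
qed

lemma indep_weight_children:
  assumes [measurable]: "h \<in> borel_measurable borel" and g: "g \<in> borel_measurable families"
  shows "indep_var borel (\<lambda>x. h (weight U e x) :: real) borel (\<lambda>x. g (children e x) :: real)"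
proof -
  have *: "(\<lambda>z. family_weight e z) \<in> borel_measurable (\<Pi>\<^sub>M c\<in>- {e}. families)"
    by (rule weight_measurable_families) auto
  show ?thesis
    using indep_var_children[OF measurable_compose[OF * assms(1)] g]
    by (simp add: weight_other_children[of e e, symmetric])
qed

text \<open>
  Conditionally on \<open>w\<^sub>e\<close>, the children of \<open>e\<close> contribute \<open>w\<^sub>e\<^sup>q \<Sum>\<^sub>i u\<^sub>e\<^sub>i\<^sup>q\<close>, and the second factor is
  independent of the first; each generation multiplies the sum by the same factor. The case
  \<open>q = 1\<close> gives the mean of the total mass, \<open>q = p\<close> the geometric decay.
\<close>

lemma moment_weights:
  assumes int: "\<And>i. integrable N (\<lambda>y. u i y powr q)"
  shows "integrable M (\<lambda>x. weight U e x powr q)"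
    and "(\<integral>x. (\<Sum>e\<in>words k n. weight U e x powr q) \<partial>M) = (\<integral>y. (\<Sum>i<k. u i y powr q) \<partial>N) ^ n"
proof -
  interpret N: prob_space N by (rule N)
  have AE_snoc: "AE x in M. weight U (e @ [i]) x powr q
      = weight U e x powr q * children e x i powr q" for e i
    using AE_weight_nonneg AE_U_nonneg
    by eventually_elim (auto simp: powr_mult children_def)
  have coord [measurable]: "(\<lambda>z. z i powr q) \<in> borel_measurable families" for i
    by measurable
  have int_child: "integrable M (\<lambda>x. children e x i powr q)" for e i
    using int[of i] integrable_children[OF coord[of i], of e] by simp
  have indep: "indep_var borel (\<lambda>x. weight U e x powr q) borel (\<lambda>x. children e x i powr q)" for e i
    by (rule indep_weight_children) measurable
  show int_w: "integrable M (\<lambda>x. weight U e x powr q)" for e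
  proof (induction e rule: rev_induct)
    case (snoc i e)
    show ?case
      using indep_var_integrable[OF indep snoc int_child] AE_snoc
      by (subst integrable_cong_AE[OF _ _ AE_snoc]) auto
  qed simp
  have step: "(\<integral>x. weight U (e @ [i]) x powr q \<partial>M)
      = (\<integral>x. weight U e x powr q \<partial>M) * (\<integral>y. u i y powr q \<partial>N)" for e i
  proof -
    have "(\<integral>x. weight U (e @ [i]) x powr q \<partial>M)
        = (\<integral>x. weight U e x powr q * children e x i powr q \<partial>M)"
      by (rule integral_cong_AE[OF _ _ AE_snoc]) auto
    also have "\<dots> = (\<integral>x. weight U e x powr q \<partial>M) * (\<integral>x. children e x i powr q \<partial>M)"
      by (rule indep_var_lebesgue_integral[OF indep int_w int_child])
    finally show ?thesis using integral_children[OF coord[of i], of e] by simp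
  qed
  show "(\<integral>x. (\<Sum>e\<in>words k n. weight U e x powr q) \<partial>M) = (\<integral>y. (\<Sum>i<k. u i y powr q) \<partial>N) ^ n"
  proof (induction n)
    case 0
    show ?case by (simp add: prob_space)
  next
    case (Suc n)
    have "(\<integral>x. (\<Sum>e\<in>words k (Suc n). weight U e x powr q) \<partial>M)
        = (\<Sum>e\<in>words k n. \<Sum>i<k. \<integral>x. weight U (e @ [i]) x powr q \<partial>M)"
      by (subst sum_words_Suc) (simp add: int_w del: weight_snoc)
    also have "\<dots> = (\<Sum>e\<in>words k n. \<integral>x. weight U e x powr q \<partial>M) * (\<Sum>i<k. \<integral>y. u i y powr q \<partial>N)"
      unfolding step by (simp add: sum_product)
    also have "\<dots> = (\<integral>y. (\<Sum>i<k. u i y powr q) \<partial>N) ^ Suc n"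
      using Suc by (simp add: int_w int)
    finally show ?case .
  qed
qed

section \<open>The mass of the offspring of one particle\<close>

sublocale N: prob_space N by (rule N)

text \<open>
  The sum of the \<open>u\<^sub>i\<close> is almost surely finite; where it is infinite, this real version is \<open>0\<close>.
\<close>

definition offspring_mass :: "'b \<Rightarrow> real" where
  "offspring_mass y = enn2real (\<Sum>i. ennreal (u i y))"

lemma offspring_mass_meas [measurable]: "offspring_mass \<in> borel_measurable N"
  unfolding offspring_mass_def by measurable

lemma offspring_mass_nonneg: "0 \<le> offspring_mass y"
  by (simp add: offspring_mass_def)

lemma AE_offspring_mass: "AE y in N. (\<Sum>i. ennreal (u i y)) = ennreal (offspring_mass y)"
proof -
  have "AE y in N. (\<Sum>i. ennreal (u i y)) \<noteq> \<infinity>"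
    by (rule nn_integral_PInf_AE) (auto simp: mean_one)
  thus ?thesis by eventually_elim (auto simp: offspring_mass_def less_top)
qed

lemma AE_partial_sums: "AE y in N. (\<lambda>i. u i y) sums offspring_mass y"
  using AE_offspring_mass AE_space
proof eventually_elim
  case (elim y)
  note [simp] = u_nonneg[OF elim(2)]
  have "summable (\<lambda>i. u i y)"
    by (rule summable_suminf_not_top) (use elim(1) in auto)
  moreover from this have "ennreal (\<Sum>i. u i y) = ennreal (offspring_mass y)"
    using elim(1) by (simp add: suminf_ennreal2)
  ultimately show ?case
    by (simp add: sums_iff offspring_mass_nonneg suminf_nonneg)
qed

lemma AE_partial_sum_le: "AE y in N. (\<Sum>i<k. u i y) \<le> offspring_mass y"
  using AE_partial_sums AE_space
proof eventually_elim
  case (elim y)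
  thus ?case
    using sum_le_suminf[of "\<lambda>i. u i y" "{..<k}"] u_nonneg by (auto simp: sums_iff)
qed

lemma nn_integral_offspring_mass: "(\<integral>\<^sup>+y. ennreal (offspring_mass y) \<partial>N) = 1"
  using nn_integral_cong_AE[OF AE_offspring_mass] mean_one by simp

lemma integrable_offspring_mass [simp]: "integrable N offspring_mass"
  and integral_offspring_mass: "(\<integral>y. offspring_mass y \<partial>N) = 1"
proof -
  show int: "integrable N offspring_mass"
    by (rule integrableI_nonneg) (auto simp: offspring_mass_nonneg nn_integral_offspring_mass)
  have "ennreal (\<integral>y. offspring_mass y \<partial>N) = 1"
    using nn_integral_eq_integral[OF int] by (simp add: offspring_mass_nonneg nn_integral_offspring_mass)
  thus "(\<integral>y. offspring_mass y \<partial>N) = 1" by simp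
qed

lemma integrable_partial_sum [simp]: "integrable N (\<lambda>y. \<Sum>i<k. u i y)"
proof (rule Bochner_Integration.integrable_bound[OF integrable_offspring_mass])
  show "AE y in N. norm (\<Sum>i<k. u i y) \<le> norm (offspring_mass y)"
    using AE_partial_sum_le[of k] AE_space
    by eventually_elim (auto simp: offspring_mass_nonneg sum_nonneg u_nonneg)
qed simp

lemma integrable_u [simp]: "integrable N (u i)"
proof (rule Bochner_Integration.integrable_bound[OF integrable_partial_sum[of "Suc i"]])
  show "AE y in N. norm (u i y) \<le> norm (\<Sum>i<Suc i. u i y)"
    using AE_space by eventually_elim (simp add: sum_nonneg u_nonneg)
qed simp

definition mean_partial :: "nat \<Rightarrow> real" where
  "mean_partial k = (\<integral>y. (\<Sum>i<k. u i y) \<partial>N)"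

lemma mean_partial_nonneg: "0 \<le> mean_partial k"
  unfolding mean_partial_def by (rule Bochner_Integration.integral_nonneg) (auto intro!: sum_nonneg u_nonneg)

lemma mean_partial_le_1: "mean_partial k \<le> 1"
  unfolding mean_partial_def integral_offspring_mass[symmetric]
  by (rule integral_mono_AE) (auto intro: AE_partial_sum_le)

lemma mean_partial_tendsto: "mean_partial \<longlonglongrightarrow> 1"
  unfolding mean_partial_def integral_offspring_mass[symmetric]
proof (rule integral_dominated_convergence[where w = offspring_mass])
  show "AE y in N. (\<lambda>k. \<Sum>i<k. u i y) \<longlonglongrightarrow> offspring_mass y"
    using AE_partial_sums by eventually_elim (simp add: sums_def)
  show "AE y in N. norm (\<Sum>i<k. u i y) \<le> offspring_mass y" for k
    using AE_partial_sum_le[of k] AE_space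
    by eventually_elim (simp add: sum_nonneg u_nonneg)
qed auto

lemma integrable_weight [simp]: "integrable M (weight U e)"
  and sum_expectation_weight: "(\<Sum>e\<in>words k n. \<integral>x. weight U e x \<partial>M) = mean_partial k ^ n"
proof -
  have AE_eq: "AE x in M. weight U e x powr 1 = weight U e x" for e
    using AE_weight_nonneg by eventually_elim simp
  have u1: "u i y powr 1 = u i y" if "y \<in> space N" for i y
    using that by (simp add: u_nonneg)
  have int1: "integrable N (\<lambda>y. u i y powr 1)" for i
    by (subst Bochner_Integration.integrable_cong[OF refl u1]) auto
  show int: "integrable M (weight U e)" for e
    using moment_weights(1)[OF int1] by (subst integrable_cong_AE[OF _ _ AE_eq, symmetric]) auto
  have "(\<Sum>e\<in>words k n. \<integral>x. weight U e x \<partial>M) = (\<Sum>e\<in>words k n. \<integral>x. weight U e x powr 1 \<partial>M)"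
    by (intro sum.cong refl integral_cong_AE[OF _ _ AE_eq, symmetric]) auto
  also have "\<dots> = (\<integral>y. (\<Sum>i<k. u i y powr 1) \<partial>N) ^ n"
    using moment_weights[OF int1] by simp
  also have "(\<integral>y. (\<Sum>i<k. u i y powr 1) \<partial>N) = mean_partial k"
    unfolding mean_partial_def by (intro Bochner_Integration.integral_cong) (auto simp: u_nonneg)
  finally show "(\<Sum>e\<in>words k n. \<integral>x. weight U e x \<partial>M) = mean_partial k ^ n" .
qed

section \<open>Orthogonality of the centred offspring\<close>

text \<open>
  For distinct words \<open>e\<close>, \<open>f\<close> of the same length, the offspring of \<open>f\<close> is independent of \<open>w\<^sub>e\<close>, \<open>w\<^sub>f\<close>
  and the offspring of \<open>e\<close> jointly; since \<open>g\<close> is centred, the off-diagonal terms of the square vanish.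
  Boundedness of \<open>h\<close> and \<open>g\<close> makes all products integrable.
\<close>

lemma expectation_square_sum:
  fixes h :: "real \<Rightarrow> real" and g :: "(nat \<Rightarrow> real) \<Rightarrow> real"
  assumes [measurable]: "h \<in> borel_measurable borel" "g \<in> borel_measurable families"
    and h: "\<And>w. \<bar>h w\<bar> \<le> 1" and g: "\<And>z. \<bar>g z\<bar> \<le> B"
    and centred: "(\<integral>y. g (\<lambda>i. u i y) \<partial>N) = 0"
    and F: "finite F" "\<And>e. e \<in> F \<Longrightarrow> length e = n"
  shows "integrable M (\<lambda>x. (\<Sum>e\<in>F. h (weight U e x) * g (children e x))\<^sup>2)"
    and "(\<integral>x. (\<Sum>e\<in>F. h (weight U e x) * g (children e x))\<^sup>2 \<partial>M)
       = (\<Sum>e\<in>F. (\<integral>x. (h (weight U e x))\<^sup>2 \<partial>M) * (\<integral>y. (g (\<lambda>i. u i y))\<^sup>2 \<partial>N))"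
proof -
  define X where "X e f x = h (weight U e x) * h (weight U f x) * g (children e x)" for e f x
  have [measurable]: "X e f \<in> borel_measurable M" for e f unfolding X_def by measurable
  have B: "0 \<le> B" using g[of undefined] by linarith
  have X_bound: "\<bar>X e f x\<bar> \<le> B" for e f x
  proof -
    have "\<bar>X e f x\<bar> \<le> 1 * 1 * B"
      unfolding X_def abs_mult using h g B by (intro mult_mono) auto
    thus ?thesis by simp
  qed
  have int_X: "integrable M (X e f)" for e f
    by (rule integrable_const_bound[of _ B]) (use X_bound in auto)
  have int_g: "integrable M (\<lambda>x. g (children e x))" for e
    by (rule integrable_const_bound[of _ B]) (use g in auto)
  have int_term: "integrable M (\<lambda>x. X e f x * g (children f x))" for e f
  proof (rule integrable_const_bound[of _ "B * B"])
    show "AE x in M. norm (X e f x * g (children f x)) \<le> B * B"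
      using X_bound g B by (auto simp: abs_mult intro!: mult_mono)
  qed simp
  have off_diagonal: "(\<integral>x. X e f x * g (children f x) \<partial>M) = 0"
    if "e \<in> F" "f \<in> F" "e \<noteq> f" for e f
  proof -
    have [measurable]: "family_weight e \<in> borel_measurable (\<Pi>\<^sub>M c\<in>- {f}. families)"
        "family_weight f \<in> borel_measurable (\<Pi>\<^sub>M c\<in>- {f}. families)"
      by (rule weight_measurable_families; use that F in auto)+
    have [measurable]: "(\<lambda>z. z e) \<in> (\<Pi>\<^sub>M c\<in>- {f}. families) \<rightarrow>\<^sub>M families"
      by (rule measurable_component_singleton) (use that in auto)
    have "(\<lambda>z. h (family_weight e z) * h (family_weight f z) * g (z e)) \<in> borel_measurable (\<Pi>\<^sub>M c\<in>- {f}. families)"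
      by measurable
    from indep_var_children[OF this assms(2)]
    have "indep_var borel (X e f) borel (\<lambda>x. g (children f x))"
      unfolding X_def using that F
      by (simp add: weight_other_children[of e f, symmetric] weight_other_children[of f f, symmetric])
    hence "(\<integral>x. X e f x * g (children f x) \<partial>M) = (\<integral>x. X e f x \<partial>M) * (\<integral>x. g (children f x) \<partial>M)"
      by (rule indep_var_lebesgue_integral[OF _ int_X int_g])
    thus ?thesis using integral_children[OF assms(2), of f] centred by simp
  qed
  have diagonal: "(\<integral>x. X e e x * g (children e x) \<partial>M)
      = (\<integral>x. (h (weight U e x))\<^sup>2 \<partial>M) * (\<integral>y. (g (\<lambda>i. u i y))\<^sup>2 \<partial>N)" for e
  proof -
    have "indep_var borel (\<lambda>x. (h (weight U e x))\<^sup>2) borel (\<lambda>x. (g (children e x))\<^sup>2)"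
      by (rule indep_weight_children[of "\<lambda>w. (h w)\<^sup>2" "\<lambda>z. (g z)\<^sup>2"]) measurable
    moreover have "integrable M (\<lambda>x. (h (weight U e x))\<^sup>2)"
      by (rule integrable_const_bound[of _ "1\<^sup>2"]) (use h in \<open>auto simp: abs_square_le_1\<close>)
    moreover have "integrable M (\<lambda>x. (g (children e x))\<^sup>2)"
    proof (rule integrable_const_bound[of _ "B\<^sup>2"])
      show "AE x in M. norm ((g (children e x))\<^sup>2) \<le> B\<^sup>2"
        using power_mono[OF g abs_ge_zero, of _ 2] by simp
    qed simp
    ultimately have "(\<integral>x. (h (weight U e x))\<^sup>2 * (g (children e x))\<^sup>2 \<partial>M)
        = (\<integral>x. (h (weight U e x))\<^sup>2 \<partial>M) * (\<integral>x. (g (children e x))\<^sup>2 \<partial>M)"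
      by (rule indep_var_lebesgue_integral)
    moreover have "X e e x * g (children e x) = (h (weight U e x))\<^sup>2 * (g (children e x))\<^sup>2" for x
      by (simp add: X_def power2_eq_square)
    moreover have "(\<integral>x. (g (children e x))\<^sup>2 \<partial>M) = (\<integral>y. (g (\<lambda>i. u i y))\<^sup>2 \<partial>N)"
      by (rule integral_children) measurable
    ultimately show ?thesis by simp
  qed
  have expand: "(\<Sum>e\<in>F. h (weight U e x) * g (children e x))\<^sup>2
      = (\<Sum>e\<in>F. \<Sum>f\<in>F. X e f x * g (children f x))" for x
    unfolding power2_eq_square sum_product X_def by (intro sum.cong refl) (simp add: mult_ac)
  show "integrable M (\<lambda>x. (\<Sum>e\<in>F. h (weight U e x) * g (children e x))\<^sup>2)"
    unfolding expand using int_term by simp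
  have "(\<integral>x. (\<Sum>e\<in>F. h (weight U e x) * g (children e x))\<^sup>2 \<partial>M)
      = (\<Sum>e\<in>F. \<Sum>f\<in>F. \<integral>x. X e f x * g (children f x) \<partial>M)"
    unfolding expand using int_term by simp
  also have "\<dots> = (\<Sum>e\<in>F. \<Sum>f\<in>F. if f = e then \<integral>x. X e e x * g (children e x) \<partial>M else 0)"
    by (intro sum.cong refl) (auto simp: off_diagonal)
  also have "\<dots> = (\<Sum>e\<in>F. \<integral>x. X e e x * g (children e x) \<partial>M)"
    using F(1) by simp
  finally show "(\<integral>x. (\<Sum>e\<in>F. h (weight U e x) * g (children e x))\<^sup>2 \<partial>M)
       = (\<Sum>e\<in>F. (\<integral>x. (h (weight U e x))\<^sup>2 \<partial>M) * (\<integral>y. (g (\<lambda>i. u i y))\<^sup>2 \<partial>N))"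
    by (simp add: diagonal)
qed

section \<open>One step of the cascade on finitely many letters\<close>

lemma expectation_abs_le_sqrt:
  fixes X :: "'a \<Rightarrow> real"
  assumes "integrable M X" "integrable M (\<lambda>x. (X x)\<^sup>2)"
  shows "(\<integral>x. \<bar>X x\<bar> \<partial>M) \<le> sqrt (\<integral>x. (X x)\<^sup>2 \<partial>M)"
proof -
  have "0 \<le> variance (\<lambda>x. \<bar>X x\<bar>)" by (rule variance_positive)
  also have "\<dots> = (\<integral>x. (X x)\<^sup>2 \<partial>M) - (\<integral>x. \<bar>X x\<bar> \<partial>M)\<^sup>2"
    using assms by (subst variance_eq) auto
  finally show ?thesis by (intro real_le_rsqrt) simp
qed

definition offspring_tail :: "real \<Rightarrow> real" where
  "offspring_tail R = (\<integral>y. (if R < offspring_mass y then offspring_mass y else 0) \<partial>N)"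

lemma integrable_offspring_tail [simp]: "integrable N (\<lambda>y. if R < offspring_mass y then offspring_mass y else 0)"
  by (rule Bochner_Integration.integrable_bound[OF integrable_offspring_mass]) (auto simp: offspring_mass_nonneg)

lemma offspring_tail_nonneg: "0 \<le> offspring_tail R"
  unfolding offspring_tail_def by (rule Bochner_Integration.integral_nonneg) (auto simp: offspring_mass_nonneg)

text \<open>
  The cut variables are bounded and non-negative at every point of the space, also where \<open>U\<close> takes
  negative values, which happens only on a null set.
\<close>

definition clip :: "real \<Rightarrow> real" where
  "clip w = (if 0 \<le> w \<and> w \<le> 1 then w else 0)"

definition bounded_mass :: "nat \<Rightarrow> real \<Rightarrow> (nat \<Rightarrow> real) \<Rightarrow> real" where
  "bounded_mass k R z = (if 0 \<le> (\<Sum>i<k. z i) \<and> (\<Sum>i<k. z i) \<le> R then \<Sum>i<k. z i else 0)"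

lemma clip_meas [measurable]: "clip \<in> borel_measurable borel"
  unfolding clip_def by measurable

lemma bounded_mass_meas [measurable]: "bounded_mass k R \<in> borel_measurable families"
  unfolding bounded_mass_def by measurable

lemma clip_bounds: "0 \<le> clip w" "clip w \<le> 1"
  by (auto simp: clip_def)

lemma bounded_mass_bounds:
  assumes "0 \<le> R"
  shows "0 \<le> bounded_mass k R z" "bounded_mass k R z \<le> R"
  using assms by (auto simp: bounded_mass_def)

definition mean_bounded :: "nat \<Rightarrow> real \<Rightarrow> real" where
  "mean_bounded k R = (\<integral>y. bounded_mass k R (\<lambda>i. u i y) \<partial>N)"

lemma integrable_bounded_mass:
  assumes "0 \<le> R"
  shows "integrable N (\<lambda>y. bounded_mass k R (\<lambda>i. u i y))"
  by (rule N.integrable_const_bound[of _ R]) (use bounded_mass_bounds[OF assms] in auto)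

lemma mean_bounded_bounds:
  assumes R: "0 \<le> R"
  shows "0 \<le> mean_bounded k R" "mean_bounded k R \<le> R" "mean_bounded k R \<le> mean_partial k"
    and "mean_partial k - mean_bounded k R \<le> offspring_tail R"
proof -
  note int = integrable_bounded_mass[OF R, of k]
  show "0 \<le> mean_bounded k R"
    unfolding mean_bounded_def
    by (rule Bochner_Integration.integral_nonneg) (simp add: bounded_mass_bounds R)
  have "mean_bounded k R \<le> (\<integral>y. R \<partial>N)"
    unfolding mean_bounded_def by (rule integral_mono[OF int]) (simp_all add: bounded_mass_bounds R)
  thus "mean_bounded k R \<le> R" by (simp add: N.prob_space)
  show "mean_bounded k R \<le> mean_partial k"
    unfolding mean_bounded_def mean_partial_def
    by (rule integral_mono[OF int]) (auto simp: bounded_mass_def u_nonneg sum_nonneg)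
  have "mean_partial k - mean_bounded k R
      = (\<integral>y. (\<Sum>i<k. u i y) - bounded_mass k R (\<lambda>i. u i y) \<partial>N)"
    unfolding mean_bounded_def mean_partial_def using int by simp
  also have "\<dots> \<le> offspring_tail R"
    unfolding offspring_tail_def
  proof (rule integral_mono_AE)
    show "AE y in N. (\<Sum>i<k. u i y) - bounded_mass k R (\<lambda>i. u i y) \<le> (if R < offspring_mass y then offspring_mass y else 0)"
      using AE_partial_sum_le[of k] AE_space
    proof eventually_elim
      case (elim y)
      have "0 \<le> (\<Sum>i<k. u i y)" using elim by (auto intro!: sum_nonneg u_nonneg)
      thus ?case using elim offspring_mass_nonneg[of y] by (auto simp: bounded_mass_def)
    qed
  qed (use int in auto)
  finally show "mean_partial k - mean_bounded k R \<le> offspring_tail R" .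
qed

text \<open>
  With \<open>T\<close> the mass cut at \<open>R\<close>, one has \<open>T\<^sup>2 \<le> R T\<close> and \<open>E T \<le> 1\<close>.
\<close>

lemma variance_bounded_mass:
  assumes R: "0 \<le> R"
  shows "(\<integral>y. (bounded_mass k R (\<lambda>i. u i y) - mean_bounded k R)\<^sup>2 \<partial>N) \<le> R"
proof -
  let ?T = "\<lambda>y. bounded_mass k R (\<lambda>i. u i y)"
  note int = integrable_bounded_mass[OF R, of k]
  have sq: "(?T y)\<^sup>2 \<le> R * ?T y" for y
    unfolding power2_eq_square using bounded_mass_bounds[OF R] by (intro mult_right_mono)
  have int2: "integrable N (\<lambda>y. (?T y)\<^sup>2)"
    by (rule Bochner_Integration.integrable_bound[OF integrable_mult_right[OF int, of R]])
       (use sq bounded_mass_bounds[OF R] R in auto)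
  have "(\<integral>y. (?T y - mean_bounded k R)\<^sup>2 \<partial>N) = (\<integral>y. (?T y)\<^sup>2 \<partial>N) - (mean_bounded k R)\<^sup>2"
    unfolding mean_bounded_def by (rule N.variance_eq[OF int int2])
  also have "\<dots> \<le> (\<integral>y. (?T y)\<^sup>2 \<partial>N)" by simp
  also have "\<dots> \<le> (\<integral>y. R * ?T y \<partial>N)"
    by (rule integral_mono[OF int2]) (use int sq in auto)
  also have "\<dots> = R * mean_bounded k R" by (simp add: mean_bounded_def)
  also have "\<dots> \<le> R * 1"
    using mean_bounded_bounds(3)[OF R, of k] mean_partial_le_1[of k] R by (intro mult_left_mono) auto
  finally show ?thesis by simp
qed

text \<open>
  With \<open>a\<^sub>e\<close> and \<open>T\<^sub>e\<close> the cut versions of \<open>w\<^sub>e\<close> and \<open>S\<^sub>e\<close>, and \<open>t = E T\<^sub>e\<close>, the increment is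
  \<open>\<Sum> a\<^sub>e (T\<^sub>e - t) + \<Sum> (w\<^sub>e S\<^sub>e - a\<^sub>e T\<^sub>e) - \<Sum> (w\<^sub>e - a\<^sub>e t)\<close>. The first sum is handled in \<open>L\<^sup>2\<close>. The terms of
  the other two are almost surely non-negative, so their \<open>L\<^sup>1\<close> norms are plain expectations, together at most
  \<open>2 \<Sum> (E w\<^sub>e - t E a\<^sub>e)\<close>. Here \<open>E w\<^sub>e - E a\<^sub>e \<le> E w\<^sub>e\<^sup>p\<close>, and \<open>1 - t\<close> is made up of the tail of the offspring
  mass and of the loss \<open>1 - mean_partial k\<close> caused by the missing letters.
\<close>

lemma truncated_increment:
  assumes p: "1 < p" "p \<le> 2" and int_p: "\<And>i. integrable N (\<lambda>y. u i y powr p)"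
    and \<mu>: "(\<integral>y. (\<Sum>i<k. u i y powr p) \<partial>N) \<le> \<mu>" and R: "0 \<le> R"
  defines "G \<equiv> \<lambda>n x. \<Sum>e\<in>words k n. weight U e x"
  shows "integrable M (\<lambda>x. G (Suc n) x - G n x)"
    and "(\<integral>x. \<bar>G (Suc n) x - G n x\<bar> \<partial>M)
      \<le> sqrt (\<mu> ^ n * R) + 2 * \<mu> ^ n + 2 * offspring_tail R + 2 * (1 - mean_partial k)"
proof -
  define W where "W = weight U"
  define a where "a e x = clip (W e x)" for e x
  define T where "T e x = bounded_mass k R (children e x)" for e x
  define S where "S e x = (\<Sum>i<k. children e x i)" for e x
  define t where "t = mean_bounded k R"
  let ?F = "words k n"
  let ?EW = "\<lambda>e. \<integral>x. W e x \<partial>M" and ?Ea = "\<lambda>e. \<integral>x. a e x \<partial>M"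
  have [measurable]: "W e \<in> borel_measurable M" "a e \<in> borel_measurable M"
      "S e \<in> borel_measurable M" "T e \<in> borel_measurable M" for e
    unfolding W_def a_def S_def T_def by measurable
  have t: "0 \<le> t" "t \<le> R" "t \<le> 1"
    using mean_bounded_bounds[OF R, of k] mean_partial_le_1[of k] by (auto simp: t_def)
  have a: "0 \<le> a e x" "a e x \<le> 1" for e x by (simp_all add: a_def clip_bounds)
  have T: "0 \<le> T e x" "T e x \<le> R" for e x by (simp_all add: T_def bounded_mass_bounds R)
  have AE_pos: "AE x in M. \<forall>e. 0 \<le> W e x \<and> a e x \<le> W e x \<and> T e x \<le> S e x"
    using AE_weight_nonneg AE_U_nonneg
    by eventually_elim
       (auto simp: a_def W_def clip_def T_def S_def bounded_mass_def children_def intro!: sum_nonneg)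

  have \<mu>0: "0 \<le> \<mu>"
    by (rule order.trans[OF Bochner_Integration.integral_nonneg \<mu>]) (simp add: sum_nonneg)
  have moment_p: "(\<Sum>e\<in>?F. \<integral>x. W e x powr p \<partial>M) \<le> \<mu> ^ n"
  proof -
    have "(\<Sum>e\<in>?F. \<integral>x. W e x powr p \<partial>M) = (\<integral>y. (\<Sum>i<k. u i y powr p) \<partial>N) ^ n"
      using moment_weights[OF int_p] by (simp add: W_def)
    also have "\<dots> \<le> \<mu> ^ n"
      by (intro power_mono \<mu> Bochner_Integration.integral_nonneg) (simp add: sum_nonneg)
    finally show ?thesis .
  qed
  have int_Wp: "integrable M (\<lambda>x. W e x powr p)" for e
    using moment_weights(1)[OF int_p] by (simp add: W_def)
  have int_W [simp]: "integrable M (W e)" for e by (simp add: W_def)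
  have sum_EW: "(\<Sum>e\<in>?F. ?EW e) \<le> 1"
    using sum_expectation_weight[of k n] mean_partial_nonneg mean_partial_le_1
    by (simp add: W_def power_le_one)
  have int_a [simp]: "integrable M (a e)" for e
    by (rule integrable_const_bound[of _ 1]) (use a in auto)
  have int_T [simp]: "integrable M (T e)" for e
    by (rule integrable_const_bound[of _ R]) (use T in auto)
  have S_N: "(\<lambda>z. \<Sum>i<k. z i) \<in> borel_measurable families" by measurable
  have int_S [simp]: "integrable M (S e)" for e
    using integrable_children[OF S_N, of e] by (simp add: S_def[abs_def])
  have E_S: "(\<integral>x. S e x \<partial>M) = mean_partial k" for e
    using integral_children[OF S_N, of e] by (simp add: S_def mean_partial_def)
  have E_T: "(\<integral>x. T e x \<partial>M) = t" for e
    unfolding T_def t_def mean_bounded_def by (rule integral_children) measurable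
  have indep_WS: "indep_var borel (W e) borel (S e)" for e
    unfolding W_def S_def
    using indep_weight_children[OF measurable_ident_sets[OF refl] S_N, of e] by simp
  have indep_aT: "indep_var borel (a e) borel (T e)" for e
    unfolding a_def T_def W_def by (rule indep_weight_children) measurable
  note int_WS [simp] = indep_var_integrable[OF indep_WS int_W int_S]
  note int_aT [simp] = indep_var_integrable[OF indep_aT int_a int_T]
  note E_WS = indep_var_lebesgue_integral[OF indep_WS int_W int_S, unfolded E_S]
  note E_aT = indep_var_lebesgue_integral[OF indep_aT int_a int_T, unfolded E_T]

  have increment: "G (Suc n) x - G n x = (\<Sum>e\<in>?F. W e x * S e x) - (\<Sum>e\<in>?F. W e x)" for x
    unfolding G_def W_def S_def children_def by (simp add: sum_words_Suc sum_distrib_left)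
  show int_inc: "integrable M (\<lambda>x. G (Suc n) x - G n x)"
    unfolding increment by simp

  define Z where "Z x = (\<Sum>e\<in>?F. a e x * (T e x - t))" for x
  have int_Z [simp]: "integrable M Z"
    unfolding Z_def by (simp add: right_diff_distrib)
  have "AE x in M. \<bar>G (Suc n) x - G n x\<bar>
      \<le> \<bar>Z x\<bar> + ((\<Sum>e\<in>?F. W e x * S e x - a e x * T e x) + (\<Sum>e\<in>?F. W e x - a e x * t))"
    using AE_pos
  proof eventually_elim
    case (elim x)
    have "0 \<le> (\<Sum>e\<in>?F. W e x * S e x - a e x * T e x)"
    proof (intro sum_nonneg)
      fix e
      have "a e x * T e x \<le> W e x * S e x" using elim a T by (intro mult_mono) auto
      thus "0 \<le> W e x * S e x - a e x * T e x" by simp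
    qed
    moreover have "0 \<le> (\<Sum>e\<in>?F. W e x - a e x * t)"
    proof (intro sum_nonneg)
      fix e
      have "a e x * t \<le> W e x * 1" using elim a t by (intro mult_mono) auto
      thus "0 \<le> W e x - a e x * t" by simp
    qed
    moreover have "G (Suc n) x - G n x
        = Z x + (\<Sum>e\<in>?F. W e x * S e x - a e x * T e x) - (\<Sum>e\<in>?F. W e x - a e x * t)"
      unfolding increment Z_def by (simp add: sum_subtractf right_diff_distrib)
    ultimately show ?case by linarith
  qed
  hence "(\<integral>x. \<bar>G (Suc n) x - G n x\<bar> \<partial>M)
      \<le> (\<integral>x. \<bar>Z x\<bar> + ((\<Sum>e\<in>?F. W e x * S e x - a e x * T e x) + (\<Sum>e\<in>?F. W e x - a e x * t)) \<partial>M)"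
    using int_inc by (intro integral_mono_AE) auto
  also have "\<dots> = (\<integral>x. \<bar>Z x\<bar> \<partial>M)
      + ((\<Sum>e\<in>?F. ?EW e * mean_partial k - ?Ea e * t) + (\<Sum>e\<in>?F. ?EW e - ?Ea e * t))"
    by (simp add: E_WS E_aT)
  also have "\<dots> \<le> sqrt (\<mu> ^ n * R) + (2 * \<mu> ^ n + 2 * (1 - t))"
  proof (rule add_mono)
    \<comment> \<open>Jensen's inequality passes to \<open>L\<^sup>2\<close>, where the centred terms are orthogonal.\<close>
    let ?g = "\<lambda>z. bounded_mass k R z - t"
    have g_meas: "?g \<in> borel_measurable families" by measurable
    have g_bound: "\<bar>?g z\<bar> \<le> R" for z
      using bounded_mass_bounds[OF R, of k z] t by (simp add: abs_le_iff)
    have centred: "(\<integral>y. ?g (\<lambda>i. u i y) \<partial>N) = 0"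
      using integrable_bounded_mass[OF R, of k] by (simp add: N.prob_space t_def mean_bounded_def)
    have clip_abs: "\<bar>clip w\<bar> \<le> 1" for w using clip_bounds[of w] by simp
    note sq = expectation_square_sum[OF clip_meas g_meas clip_abs g_bound centred, of ?F n]
    have int_Z2: "integrable M (\<lambda>x. (Z x)\<^sup>2)"
      unfolding Z_def a_def T_def W_def by (rule sq(1)) (auto simp: length_words)
    have "(\<integral>x. (Z x)\<^sup>2 \<partial>M) = (\<Sum>e\<in>?F. (\<integral>x. (a e x)\<^sup>2 \<partial>M) * (\<integral>y. (?g (\<lambda>i. u i y))\<^sup>2 \<partial>N))"
      unfolding Z_def a_def T_def W_def by (rule sq(2)) (auto simp: length_words)
    also have "\<dots> \<le> (\<Sum>e\<in>?F. (\<integral>x. W e x powr p \<partial>M) * R)"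
    proof (intro sum_mono mult_mono)
      fix e
      \<comment> \<open>Here the cut at \<open>W \<le> 1\<close> and \<open>p \<le> 2\<close> let the \<open>p\<close>-th moment control the second one.\<close>
      have *: "(a e x)\<^sup>2 \<le> W e x powr p" for x
      proof (cases "0 \<le> W e x \<and> W e x \<le> 1")
        case True
        hence "W e x powr 2 \<le> W e x powr p" using p by (intro powr_mono') auto
        thus ?thesis using True by (auto simp: a_def clip_def powr_numeral)
      qed (auto simp: a_def clip_def)
      show "(\<integral>x. (a e x)\<^sup>2 \<partial>M) \<le> (\<integral>x. W e x powr p \<partial>M)"
      proof (rule integral_mono)
        show "integrable M (\<lambda>x. (a e x)\<^sup>2)"
          by (rule integrable_const_bound[of _ 1]) (use a in \<open>auto simp: power_le_one\<close>)
      qed (use * int_Wp in auto)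
    qed (use variance_bounded_mass[OF R] R in \<open>auto simp: t_def\<close>)
    also have "\<dots> \<le> \<mu> ^ n * R"
      using moment_p R by (simp add: sum_distrib_right[symmetric] mult_right_mono)
    finally have "sqrt (\<integral>x. (Z x)\<^sup>2 \<partial>M) \<le> sqrt (\<mu> ^ n * R)" by simp
    moreover have "(\<integral>x. \<bar>Z x\<bar> \<partial>M) \<le> sqrt (\<integral>x. (Z x)\<^sup>2 \<partial>M)"
      by (rule expectation_abs_le_sqrt[OF int_Z int_Z2])
    ultimately show "(\<integral>x. \<bar>Z x\<bar> \<partial>M) \<le> sqrt (\<mu> ^ n * R)" by linarith
  next
    have "?EW e * mean_partial k - ?Ea e * t + (?EW e - ?Ea e * t)
        \<le> 2 * (\<integral>x. W e x powr p \<partial>M) + 2 * (1 - t) * ?EW e" for e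
    proof -
      have EW0: "0 \<le> ?EW e" and Ea_le: "?Ea e \<le> ?EW e"
        using AE_pos by (auto intro!: integral_nonneg_AE integral_mono_AE)
      \<comment> \<open>\<open>W - a\<close> lives on \<open>W > 1\<close>, where \<open>p > 1\<close> gives \<open>W \<le> W\<^sup>p\<close>.\<close>
      have "AE x in M. W e x - a e x \<le> W e x powr p"
        using AE_pos
      proof eventually_elim
        case (elim x)
        show ?case
        proof (cases "W e x \<le> 1")
          case False
          hence "W e x powr 1 \<le> W e x powr p" using p by (intro powr_mono) auto
          thus ?thesis using False a[of e x] by simp
        qed (use elim in \<open>simp add: a_def clip_def\<close>)
      qed
      hence "(\<integral>x. W e x - a e x \<partial>M) \<le> (\<integral>x. W e x powr p \<partial>M)"
        by (intro integral_mono_AE) (auto simp: int_Wp)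
      hence 1: "?EW e - ?Ea e \<le> (\<integral>x. W e x powr p \<partial>M)" by simp
      have 2: "?EW e * mean_partial k \<le> ?EW e"
        using EW0 mean_partial_le_1[of k] by (simp add: mult_left_le)
      have 3: "(1 - t) * ?Ea e \<le> (1 - t) * ?EW e"
        using t Ea_le by (intro mult_left_mono) auto
      show ?thesis using 1 2 3 by (simp add: algebra_simps)
    qed
    hence "(\<Sum>e\<in>?F. ?EW e * mean_partial k - ?Ea e * t + (?EW e - ?Ea e * t))
        \<le> (\<Sum>e\<in>?F. 2 * (\<integral>x. W e x powr p \<partial>M) + 2 * (1 - t) * ?EW e)"
      by (intro sum_mono)
    also have "\<dots> = 2 * (\<Sum>e\<in>?F. \<integral>x. W e x powr p \<partial>M) + 2 * (1 - t) * (\<Sum>e\<in>?F. ?EW e)"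
      by (simp add: sum.distrib sum_distrib_left)
    also have "\<dots> \<le> 2 * \<mu> ^ n + 2 * (1 - t) * 1"
      using moment_p sum_EW t by (intro add_mono mult_left_mono) auto
    finally show "(\<Sum>e\<in>?F. ?EW e * mean_partial k - ?Ea e * t) + (\<Sum>e\<in>?F. ?EW e - ?Ea e * t)
        \<le> 2 * \<mu> ^ n + 2 * (1 - t)"
      by (simp only: sum.distrib mult_1_right)
  qed
  also have "\<dots> \<le> sqrt (\<mu> ^ n * R) + 2 * \<mu> ^ n + 2 * offspring_tail R + 2 * (1 - mean_partial k)"
    using mean_bounded_bounds(4)[OF R, of k] by (simp add: t_def)
  finally show "(\<integral>x. \<bar>G (Suc n) x - G n x\<bar> \<partial>M)
      \<le> sqrt (\<mu> ^ n * R) + 2 * \<mu> ^ n + 2 * offspring_tail R + 2 * (1 - mean_partial k)" .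
qed

section \<open>The increments of the total mass\<close>

lemma total_mass_meas [measurable]: "total_mass U n \<in> borel_measurable M"
  unfolding total_mass_eq_SUP[abs_def] by measurable

lemma nn_integral_total_mass_le: "(\<integral>\<^sup>+x. total_mass U n x \<partial>M) \<le> 1"
proof -
  have "(\<integral>\<^sup>+x. total_mass U n x \<partial>M) = (SUP k. \<integral>\<^sup>+x. (\<Sum>e\<in>words k n. ennreal (weight U e x)) \<partial>M)"
    unfolding total_mass_eq_SUP
    by (intro nn_integral_monotone_convergence_SUP)
       (auto simp: incseq_def le_fun_def intro!: sum_mono2 dest: words_mono[THEN subsetD])
  also have "\<dots> \<le> 1"
  proof (rule SUP_least)
    fix k
    have "(\<integral>\<^sup>+x. ennreal (weight U e x) \<partial>M) = ennreal (\<integral>x. weight U e x \<partial>M)" for e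
      using AE_weight_nonneg by (intro nn_integral_eq_integral) auto
    hence "(\<integral>\<^sup>+x. (\<Sum>e\<in>words k n. ennreal (weight U e x)) \<partial>M)
        = (\<Sum>e\<in>words k n. ennreal (\<integral>x. weight U e x \<partial>M))"
      by (simp add: nn_integral_sum)
    also have "\<dots> = ennreal (\<Sum>e\<in>words k n. \<integral>x. weight U e x \<partial>M)"
      using AE_weight_nonneg by (intro sum_ennreal integral_nonneg_AE) auto
    also have "\<dots> \<le> 1"
      using mean_partial_nonneg mean_partial_le_1
      by (simp add: sum_expectation_weight power_le_one)
    finally show "(\<integral>\<^sup>+x. (\<Sum>e\<in>words k n. ennreal (weight U e x)) \<partial>M) \<le> 1" .
  qed
  finally show ?thesis .
qed

lemma AE_total_mass_limit:
  "AE x in M. (\<lambda>k. \<Sum>e\<in>words k n. weight U e x) \<longlonglongrightarrow> enn2real (total_mass U n x)"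
proof -
  have "AE x in M. total_mass U n x \<noteq> \<infinity>"
    by (rule nn_integral_PInf_AE) (use nn_integral_total_mass_le[of n] in \<open>auto simp: top_unique\<close>)
  with AE_weight_nonneg show ?thesis
  proof eventually_elim
    case (elim x)
    have "incseq (\<lambda>k. \<Sum>e\<in>words k n. ennreal (weight U e x))"
      by (auto simp: incseq_def intro!: sum_mono2 dest: words_mono[THEN subsetD])
    hence "(\<lambda>k. \<Sum>e\<in>words k n. ennreal (weight U e x)) \<longlonglongrightarrow> total_mass U n x"
      unfolding total_mass_eq_SUP by (rule LIMSEQ_SUP)
    hence "(\<lambda>k. ennreal (\<Sum>e\<in>words k n. weight U e x)) \<longlonglongrightarrow> ennreal (enn2real (total_mass U n x))"
      using elim by (simp add: sum_ennreal less_top)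
    from tendsto_enn2real[OF this] show ?case
      using elim by (simp add: sum_nonneg)
  qed
qed

text \<open>
  Fatou's lemma as the number \<open>k\<close> of letters grows, using \<open>mean_partial k \<longlonglongrightarrow> 1\<close>.
\<close>

lemma total_mass_increment:
  assumes p: "1 < p" "p \<le> 2" and int_p: "\<And>i. integrable N (\<lambda>y. u i y powr p)"
    and \<mu>: "\<And>k. (\<integral>y. (\<Sum>i<k. u i y powr p) \<partial>N) \<le> \<mu>" and R: "0 \<le> R"
  shows "(\<integral>\<^sup>+x. ennreal \<bar>enn2real (total_mass U (Suc n) x) - enn2real (total_mass U n x)\<bar> \<partial>M)
    \<le> ennreal (sqrt (\<mu> ^ n * R) + 2 * \<mu> ^ n + 2 * offspring_tail R)"
proof -
  define G where "G k n x = (\<Sum>e\<in>words k n. weight U e x)" for k n x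
  define B where "B = sqrt (\<mu> ^ n * R) + 2 * \<mu> ^ n + 2 * offspring_tail R"
  have [measurable]: "G k n \<in> borel_measurable M" for k n unfolding G_def by measurable
  note inc = truncated_increment[OF p int_p \<mu> R, folded G_def]
  have "(\<integral>\<^sup>+x. ennreal \<bar>enn2real (total_mass U (Suc n) x) - enn2real (total_mass U n x)\<bar> \<partial>M)
      = (\<integral>\<^sup>+x. liminf (\<lambda>k. ennreal \<bar>G k (Suc n) x - G k n x\<bar>) \<partial>M)"
  proof (rule nn_integral_cong_AE)
    show "AE x in M. ennreal \<bar>enn2real (total_mass U (Suc n) x) - enn2real (total_mass U n x)\<bar>
        = liminf (\<lambda>k. ennreal \<bar>G k (Suc n) x - G k n x\<bar>)"
      using AE_total_mass_limit[of n] AE_total_mass_limit[of "Suc n"]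
    proof eventually_elim
      case (elim x)
      have "(\<lambda>k. ennreal \<bar>G k (Suc n) x - G k n x\<bar>) \<longlonglongrightarrow>
          ennreal \<bar>enn2real (total_mass U (Suc n) x) - enn2real (total_mass U n x)\<bar>"
        unfolding G_def by (intro tendsto_ennrealI tendsto_rabs tendsto_diff elim)
      thus ?case by (rule lim_imp_Liminf[OF sequentially_bot, symmetric])
    qed
  qed
  also have "\<dots> \<le> liminf (\<lambda>k. \<integral>\<^sup>+x. ennreal \<bar>G k (Suc n) x - G k n x\<bar> \<partial>M)"
    by (rule nn_integral_liminf) measurable
  also have "\<dots> \<le> liminf (\<lambda>k. ennreal (B + 2 * (1 - mean_partial k)))"
  proof (intro Liminf_mono always_eventually allI)
    fix k
    have "(\<integral>\<^sup>+x. ennreal \<bar>G k (Suc n) x - G k n x\<bar> \<partial>M)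
        = ennreal (\<integral>x. \<bar>G k (Suc n) x - G k n x\<bar> \<partial>M)"
      by (rule nn_integral_eq_integral) (use inc(1) in auto)
    also have "\<dots> \<le> ennreal (B + 2 * (1 - mean_partial k))"
      using inc(2) by (intro ennreal_leI) (simp add: B_def)
    finally show "(\<integral>\<^sup>+x. ennreal \<bar>G k (Suc n) x - G k n x\<bar> \<partial>M)
        \<le> ennreal (B + 2 * (1 - mean_partial k))" .
  qed
  also have "\<dots> = ennreal B"
  proof (rule lim_imp_Liminf[OF sequentially_bot])
    have "(\<lambda>k. ennreal (B + 2 * (1 - mean_partial k))) \<longlonglongrightarrow> ennreal (B + 2 * (1 - 1))"
      by (intro tendsto_intros mean_partial_tendsto)
    thus "(\<lambda>k. ennreal (B + 2 * (1 - mean_partial k))) \<longlonglongrightarrow> ennreal B" by simp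
  qed
  finally show ?thesis unfolding B_def .
qed

text \<open>
  The inequality \<open>r\<^sup>n < c\<close> holds only for \<open>n < log\<^sub>+ c / ln r\<close>, that is for at most
  \<open>1 + log\<^sub>+ c / ln r\<close> indices.
\<close>

lemma sum_geometric_tails_le:
  fixes c r :: real
  assumes c: "0 \<le> c" and r: "1 < r"
  shows "(\<Sum>n. ennreal (if r ^ n < c then c else 0))
    \<le> ennreal c + ennreal (1 / ln r) * (ennreal c * log_plus (ennreal c))"
proof -
  define l where "l = max (ln c) 0"
  define b where "b = l / ln r"
  have lr: "0 < ln r" using r by simp
  have b0: "0 \<le> b" using lr by (simp add: b_def l_def)
  have l: "0 \<le> l" "log_plus (ennreal c) = ennreal l"
    using c by (simp_all add: l_def log_plus_def)
  have zero: "(if r ^ n < c then c else 0) = 0" if "n \<notin> {..<nat \<lceil>b\<rceil>}" for n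
  proof -
    have "b \<le> real n" using that by (simp add: not_less nat_le_iff ceiling_le_iff)
    hence "l \<le> real n * ln r" using lr by (simp add: b_def field_simps)
    hence "ln c \<le> ln (r ^ n)" using r by (simp add: ln_realpow l_def)
    hence "c \<le> r ^ n \<or> c \<le> 0" using r by (cases "c \<le> 0") auto
    thus ?thesis using c by auto
  qed
  have "(\<Sum>n. ennreal (if r ^ n < c then c else 0))
      = (\<Sum>n<nat \<lceil>b\<rceil>. ennreal (if r ^ n < c then c else 0))"
    by (rule suminf_finite) (use zero in auto)
  also have "\<dots> \<le> (\<Sum>n<nat \<lceil>b\<rceil>. ennreal c)"
    by (intro sum_mono ennreal_leI) (use c in auto)
  also have "\<dots> = ennreal (real (nat \<lceil>b\<rceil>) * c)"
    by (simp add: ennreal_mult c ennreal_of_nat_eq_real_of_nat)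
  also have "\<dots> \<le> ennreal ((1 + b) * c)"
    using c b0 by (intro ennreal_leI mult_right_mono) linarith+
  also have "(1 + b) * c = c + 1 / ln r * (c * l)"
    by (simp add: b_def field_simps)
  also have "ennreal \<dots> = ennreal c + ennreal (1 / ln r) * (ennreal c * log_plus (ennreal c))"
    using c lr l(1) by (simp add: l(2) ennreal_mult[symmetric] ennreal_plus[symmetric] del: ennreal_plus)
  finally show ?thesis .
qed

lemma summable_offspring_tail:
  assumes log: "(\<integral>\<^sup>+y. (\<Sum>i. ennreal (u i y)) * log_plus (\<Sum>i. ennreal (u i y)) \<partial>N) < \<infinity>"
    and r: "1 < r"
  shows "summable (\<lambda>n. offspring_tail (r ^ n))"
proof (rule summable_suminf_not_top)
  have log_s: "(\<integral>\<^sup>+y. ennreal (offspring_mass y) * log_plus (ennreal (offspring_mass y)) \<partial>N) < \<infinity>"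
  proof -
    have "(\<integral>\<^sup>+y. ennreal (offspring_mass y) * log_plus (ennreal (offspring_mass y)) \<partial>N)
        = (\<integral>\<^sup>+y. (\<Sum>i. ennreal (u i y)) * log_plus (\<Sum>i. ennreal (u i y)) \<partial>N)"
      by (rule nn_integral_cong_AE) (use AE_offspring_mass in eventually_elim, simp)
    thus ?thesis using log by simp
  qed
  have [measurable]: "(\<lambda>y. log_plus (ennreal (offspring_mass y))) \<in> borel_measurable N"
    unfolding log_plus_def by measurable
  have "(\<Sum>n. ennreal (offspring_tail (r ^ n))) = (\<Sum>n. \<integral>\<^sup>+y. ennreal (if r ^ n < offspring_mass y then offspring_mass y else 0) \<partial>N)"
    unfolding offspring_tail_def
    by (intro suminf_cong nn_integral_eq_integral[symmetric]) (auto simp: offspring_mass_nonneg)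
  also have "\<dots> = (\<integral>\<^sup>+y. (\<Sum>n. ennreal (if r ^ n < offspring_mass y then offspring_mass y else 0)) \<partial>N)"
    by (rule nn_integral_suminf[symmetric]) measurable
  also have "\<dots> \<le> (\<integral>\<^sup>+y. ennreal (offspring_mass y) + ennreal (1 / ln r) * (ennreal (offspring_mass y) * log_plus (ennreal (offspring_mass y))) \<partial>N)"
    by (intro nn_integral_mono sum_geometric_tails_le offspring_mass_nonneg r)
  also have "\<dots> = (\<integral>\<^sup>+y. ennreal (offspring_mass y) \<partial>N)
      + ennreal (1 / ln r) * (\<integral>\<^sup>+y. ennreal (offspring_mass y) * log_plus (ennreal (offspring_mass y)) \<partial>N)"
    by (subst nn_integral_add) (auto simp: nn_integral_cmult)
  also have "\<dots> < \<infinity>"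
    using log_s by (simp add: nn_integral_offspring_mass ennreal_mult_less_top less_top)
  finally show "(\<Sum>n. ennreal (offspring_tail (r ^ n))) \<noteq> top" by simp
qed (rule offspring_tail_nonneg)

section \<open>Uniform integrability\<close>

theorem uniformly_integrable_total_mass:
  assumes p: "1 < p" "p \<le> 2"
    and log: "(\<integral>\<^sup>+y. (\<Sum>i. ennreal (u i y)) * log_plus (\<Sum>i. ennreal (u i y)) \<partial>N) < \<infinity>"
    and moment: "(\<integral>\<^sup>+y. (\<Sum>i. ennreal (u i y powr p)) \<partial>N) < 1"
  shows "uniformly_integrable M UNIV (total_mass U)"
proof -
  define \<mu> where "\<mu> = enn2real (\<integral>\<^sup>+y. (\<Sum>i. ennreal (u i y powr p)) \<partial>N)"
  have \<mu>: "ennreal \<mu> = (\<integral>\<^sup>+y. (\<Sum>i. ennreal (u i y powr p)) \<partial>N)"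
    unfolding \<mu>_def using moment by (intro ennreal_enn2real) (rule order.strict_trans[OF _ ennreal_one_less_top])
  have \<mu>01: "0 \<le> \<mu>" "\<mu> < 1"
    using moment unfolding \<mu>[symmetric] by (simp_all add: \<mu>_def ennreal_less_one_iff)
  have partial: "(\<integral>\<^sup>+y. ennreal (\<Sum>i<k. u i y powr p) \<partial>N) \<le> ennreal \<mu>" for k
    unfolding \<mu> by (intro nn_integral_mono) (simp add: sum_ennreal[symmetric] sum_le_suminf del: sum_ennreal)
  have int_sum: "integrable N (\<lambda>y. \<Sum>i<k. u i y powr p)" for k
    by (rule integrableI_nonneg) (use order.strict_trans1[OF partial[of k]] in \<open>auto simp: sum_nonneg\<close>)
  have int_p: "integrable N (\<lambda>y. u i y powr p)" for i
    by (rule Bochner_Integration.integrable_bound[OF int_sum[of "Suc i"]]) (auto simp: sum_nonneg)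
  have le_\<mu>: "(\<integral>y. (\<Sum>i<k. u i y powr p) \<partial>N) \<le> \<mu>" for k
  proof -
    have "ennreal (\<integral>y. (\<Sum>i<k. u i y powr p) \<partial>N) \<le> ennreal \<mu>"
      using partial[of k] by (subst nn_integral_eq_integral[OF int_sum, symmetric]) (auto simp: sum_nonneg)
    thus ?thesis using \<mu>01 by simp
  qed
  \<comment> \<open>Cutting level \<open>r\<^sup>n\<close> at generation \<open>n\<close>: the choice of \<open>r\<close> makes both \<open>r > 1\<close> (summable tails)
    and \<open>\<mu> r < 1\<close> (summable \<open>L\<^sup>2\<close> part).\<close>
  define r where "r = 2 / (1 + \<mu>)"
  have r: "1 < r" and q: "0 \<le> \<mu> * r" "\<mu> * r < 1"
    using \<mu>01 by (simp_all add: r_def field_simps)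
  define b where "b n = sqrt (\<mu> * r) ^ n + 2 * \<mu> ^ n + 2 * offspring_tail (r ^ n)" for n
  show ?thesis
  proof (rule uniformly_integrable_if_summable_increments)
    show "(\<integral>\<^sup>+x. total_mass U n x \<partial>M) < \<infinity>" for n
      using nn_integral_total_mass_le[of n] by (rule order.strict_trans1) simp
    show "(\<integral>\<^sup>+x. ennreal \<bar>enn2real (total_mass U (Suc n) x) - enn2real (total_mass U n x)\<bar> \<partial>M)
        \<le> ennreal (b n)" for n
    proof -
      have "sqrt (\<mu> ^ n * r ^ n) = sqrt (\<mu> * r) ^ n"
        by (simp only: power_mult_distrib[symmetric] real_sqrt_power)
      moreover have "0 \<le> r ^ n" using r by simp
      ultimately show ?thesis
        using total_mass_increment[OF p int_p le_\<mu>, of "r ^ n" n] by (simp only: b_def)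
    qed
    show "0 \<le> b n" for n
      using \<mu>01 q by (simp add: b_def offspring_tail_nonneg)
    show "summable b"
      unfolding b_def[abs_def] using \<mu>01 q
      by (intro summable_add summable_mult summable_geometric summable_offspring_tail[OF log r]) auto
  qed simp
qed

end

theorem proposition2:
  fixes N :: "'b measure" and u :: "nat \<Rightarrow> 'b \<Rightarrow> real"
    and M :: "'a measure" and U :: "nat list \<Rightarrow> 'a \<Rightarrow> real"
  assumes "prob_space N"
    and "\<And>i. u i \<in> borel_measurable N"
    and "\<And>i y. y \<in> space N \<Longrightarrow> 0 \<le> u i y"
    and "(\<integral>\<^sup>+y. (\<Sum>i. ennreal (u i y)) \<partial>N) = 1"
    and "prob_space M"
    and "independent_copies M U N u"
    and "\<exists>p::real. 1 < p \<and> p \<le> 2 \<and>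
           (\<integral>\<^sup>+y. (\<Sum>i. ennreal (u i y)) * log_plus (\<Sum>i. ennreal (u i y)) \<partial>N) < \<infinity> \<and>
           (\<integral>\<^sup>+y. (\<Sum>i. ennreal (u i y powr p)) \<partial>N) < 1"
  shows "uniformly_integrable M UNIV (total_mass U)"
proof -
  interpret cascade M U N u
    using assms by (auto intro!: cascade.intro cascade_axioms.intro)
  from assms(7) show ?thesis
    using uniformly_integrable_total_mass by blast
qed

end
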